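(* There exists a constant $a$ such that $$\pi_L(n) = \sum_{j=1}^{n}\ \prod_{i=1}^{\pi(\sqrt{j})}\left(1-\frac{1}{p_i}\right) \sim a\cdot\frac{n}{\log_e n}\qquad (n\to\infty).$$
   Context: $p_i$ denotes the $i$-th prime ($p_1=2$), $\pi(x)$ is the number of primes $\le x$, and an empty product equals $1$. For natural numbers $n$, $\pi_L(n)$ is defined by $\pi_L(n)=\sum_{j=1}^{n}\prod_{i=1}^{\pi(\sqrt{j})}(1-1/p_i)$. The notation $f(n)\sim g(n)$ means $f(n)/g(n)\to 1$ as $n\to\infty$. *)

theory Defs
  imports
    Complex_Main
    "HOL-Library.Infinite_Set"
    "HOL-Library.Landau_Symbols"
    "HOL-Computational_Algebra.Primes"
begin

text \<open>
  The sequence of primes is indexed from 1, whereas \<^const>\<open>enumerate\<close> counts from 0.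
  The value at index 0 is never used.
\<close>

definition nth_prime :: "nat \<Rightarrow> nat" where
  "nth_prime i = enumerate {p. prime p} (i - 1)"

definition prime_pi :: "real \<Rightarrow> nat" where
  "prime_pi x = card {p::nat. prime p \<and> real p \<le> x}"

definition pi_L :: "nat \<Rightarrow> real" where
  "pi_L n = (\<Sum>j=1..n. \<Prod>i=1..prime_pi (sqrt (real j)). 1 - 1 / real (nth_prime i))"

end

theory Submission
  imports Defs "HOL-Number_Theory.Prime_Powers" "HOL-Real_Asymp.Real_Asymp"
begin

text \<open>
  The \<open>j\<close>-th summand of \<^term>\<open>pi_L n\<close> is the product of \<open>1 - 1 / p\<close> over the primes \<open>p \<le> sqrt j\<close>. By
  Mertens' third theorem the product over \<open>p \<le> x\<close> is asymptotic to \<open>c / ln x\<close> for some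
  \<open>c > 0\<close> (\<open>mertens_third\<close>), so the summand is asymptotic to \<open>2 c / ln j\<close>. As \<open>n / ln n\<close> also
  increases by about \<open>1 / ln n\<close> from \<open>n\<close> to \<open>n + 1\<close>, the Stolz-Cesaro theorem (\<open>stolz_cesaro\<close>)
  gives the claim with \<open>a = 2 c\<close>. The constant \<open>c\<close> is obtained as the exponential of the sum of a
  convergent series, and is therefore positive.

  The arithmetic input is Mertens' first theorem, that the sum of \<open>ln p / p\<close> over
  \<open>p \<le> n\<close> is \<open>ln n + O(1)\<close> (\<open>mertens_first\<close>). It follows from the two ways of estimating
  \<open>ln n!\<close>, as a sum of logarithms and through the prime powers dividing \<open>n!\<close>, together with
  Chebyshev's bound \<open>\<psi>(n) = O(n)\<close> (\<open>chebyshev_psi_le\<close>). The bounded error in the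
  first theorem is turned into the convergent error needed for the third by Dirichlet's test
  with the weights \<open>1 / ln n\<close>.
\<close>

section \<open>Chebyshev's bound\<close>

text \<open>
  Summing \<^term>\<open>ln m\<close> as the divisor sum of the Mangoldt function over \<open>m \<le> n\<close>, each \<open>d\<close> is counted once per
  multiple of \<open>d\<close> up to \<open>n\<close>. The upper limit \<open>N\<close> is free, since \<open>n div d = 0\<close> for \<open>d > n\<close>: this
  allows logarithms of different factorials to be compared term by term.
\<close>
lemma ln_fact_eq_sum_mangoldt:
  assumes "n \<le> N"
  shows "ln (fact n :: real) = (\<Sum>d=1..N. mangoldt d * real (n div d))"
  using assms
proof (induction n)
  case 0
  then show ?case by simp
next
  case (Suc n)
  have div_Suc': "real (Suc n div d) = real (n div d) + (if d dvd Suc n then 1 else 0)" for d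
    by (simp add: div_Suc mod_eq_0_iff_dvd)
  have "(\<Sum>d=1..N. mangoldt d * real (Suc n div d))
      = (\<Sum>d=1..N. mangoldt d * real (n div d)) + (\<Sum>d=1..N. if d dvd Suc n then mangoldt d else 0)"
    unfolding sum.distrib [symmetric] by (intro sum.cong refl) (simp add: div_Suc' ring_distribs)
  also have "(\<Sum>d=1..N. if d dvd Suc n then mangoldt d else 0) = (\<Sum>d | d dvd Suc n. mangoldt d :: real)"
  proof (intro sum.mono_neutral_cong_right)
    show "{d. d dvd Suc n} \<subseteq> {1..N}"
      using Suc.prems dvd_imp_le[of _ "Suc n"] by (fastforce simp: Suc_le_eq intro!: Nat.gr0I)
  qed auto
  also have "\<dots> = ln (real (Suc n))"
    by (subst mangoldt_sum) auto
  also have "(\<Sum>d=1..N. mangoldt d * real (n div d)) = ln (fact n :: real)"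
    using Suc by simp
  also have "ln (fact n) + ln (real (Suc n)) = ln (fact (Suc n) :: real)"
    by (simp add: ln_mult)
  finally show ?case by simp
qed

lemma ln_fact_lower_bound: "real n * ln (real n) - real n \<le> ln (fact n)"
proof (induction n)
  case (Suc n)
  have "real n * (ln (real n + 1) - ln (real n)) \<le> 1"
  proof (cases "n = 0")
    case False
    then have "1 + 1 / real n = (real n + 1) / real n"
      by (simp add: field_simps)
    then have "ln (real n + 1) - ln (real n) = ln (1 + 1 / real n)"
      using False by (simp add: ln_div)
    also have "\<dots> \<le> 1 / real n"
      by (intro ln_add_one_self_le_self) auto
    finally show ?thesis
      using False by (simp add: field_simps)
  qed auto
  moreover have "ln (fact (Suc n) :: real) = ln (fact n) + ln (real n + 1)"
    by (simp add: ln_mult add.commute)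
  ultimately show ?case
    using Suc by (simp add: algebra_simps)
qed auto

lemma ln_fact_upper_bound: "ln (fact n) \<le> real n * ln (real n)"
proof (cases "n = 0")
  case False
  have "ln (fact n) \<le> ln (real n ^ n)"
    using False fact_le_power[of n, where 'a = real] by (subst ln_le_cancel_iff) auto
  then show ?thesis
    using False by (simp add: ln_realpow)
qed auto

definition chebyshev_psi :: "nat \<Rightarrow> real" where
  "chebyshev_psi n = (\<Sum>d=1..n. mangoldt d)"

text \<open>
  Chebyshev's argument. In the logarithm of the central binomial coefficient, the Mangoldt
  function is weighted with \<open>2n div d - 2 (n div d)\<close>, which is never negative and is \<open>1\<close> for
  \<open>n < d \<le> 2n\<close>; on the other hand that coefficient is at most \<open>4\<^sup>n\<close>.
\<close>
lemma chebyshev_psi_double: "chebyshev_psi (2 * n) \<le> chebyshev_psi n + 2 * real n * ln 2"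
proof -
  have choose: "real (2 * n choose n) * fact n * fact n = fact (2 * n)"
    by (subst binomial_fact) auto
  have "chebyshev_psi (2 * n) - chebyshev_psi n = (\<Sum>d\<in>{n<..2*n}. mangoldt d)"
  proof -
    have "{1..2 * n} = {1..n} \<union> {n<..2*n}" by auto
    then have "chebyshev_psi (2 * n) = chebyshev_psi n + (\<Sum>d\<in>{n<..2*n}. mangoldt d)"
      unfolding chebyshev_psi_def by (simp only:) (subst sum.union_disjoint, auto)
    then show ?thesis by simp
  qed
  also have "\<dots> = (\<Sum>d\<in>{n<..2*n}. mangoldt d * (real (2 * n div d) - 2 * real (n div d)))"
  proof (intro sum.cong refl)
    fix d assume "d \<in> {n<..2*n}"
    then have "2 * n div d = 1" "n div d = 0"
      by (auto simp: div_nat_eqI)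
    then show "mangoldt d = mangoldt d * (real (2 * n div d) - 2 * real (n div d))"
      by simp
  qed
  also have "\<dots> \<le> (\<Sum>d=1..2*n. mangoldt d * (real (2 * n div d) - 2 * real (n div d)))"
  proof (rule sum_mono2)
    fix d
    have "2 * (n div d) \<le> 2 * n div d"
      by (metis div_mult1_eq le_add1)
    then have "2 * real (n div d) \<le> real (2 * n div d)"
      by linarith
    then show "0 \<le> mangoldt d * (real (2 * n div d) - 2 * real (n div d))"
      by (intro mult_nonneg_nonneg mangoldt_nonneg) auto
  qed auto
  also have "\<dots> = ln (fact (2 * n)) - 2 * ln (fact n)"
    by (simp add: ln_fact_eq_sum_mangoldt[of _ "2 * n"] sum_subtractf right_diff_distrib
        sum_distrib_left mult_ac)
  also have "\<dots> = ln (real (2 * n choose n))"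
    by (simp add: choose [symmetric] ln_mult)
  also have "\<dots> \<le> ln (2 ^ (2 * n))"
  proof (subst ln_le_cancel_iff)
    show "real (2 * n choose n) \<le> 2 ^ (2 * n)"
      using binomial_le_pow2[of "2 * n" n] by (metis of_nat_le_iff of_nat_numeral of_nat_power)
  qed auto
  also have "\<dots> = 2 * real n * ln 2"
    by (subst ln_realpow) auto
  finally show ?thesis by simp
qed

text \<open>
  Repeated halving. For \<open>n = 2m\<close> the bound above contributes at most \<open>2m\<close>. For \<open>n = 2m + 1\<close>
  the one extra term is at most \<open>ln (2m + 1) \<le> 2m\<close>, which the generous constant \<open>4\<close> absorbs.
\<close>
lemma chebyshev_psi_le: "chebyshev_psi n \<le> 4 * real n"
proof (induction n rule: less_induct)
  case (less n)
  show ?case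
  proof (cases "n = 0")
    case True
    then show ?thesis by (simp add: chebyshev_psi_def)
  next
    case False
    define m where "m = n div 2"
    have "2 * real m * ln 2 \<le> 2 * real m * 1"
      using ln_2_less_1 by (intro mult_left_mono) auto
    moreover have "chebyshev_psi m \<le> 4 * real m"
      using False by (intro less.IH) (auto simp: m_def)
    ultimately have even: "chebyshev_psi (2 * m) \<le> 6 * real m"
      using chebyshev_psi_double[of m] by linarith
    consider "n = 2 * m" | "n = Suc (2 * m)"
      unfolding m_def by linarith
    then show ?thesis
    proof cases
      case 1
      then show ?thesis using even by simp
    next
      case 2
      have "chebyshev_psi n = chebyshev_psi (2 * m) + mangoldt n"
        using 2 by (simp add: chebyshev_psi_def)
      also have "mangoldt n \<le> ln (real n)"
        using False by (intro mangoldt_le) auto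
      also have "\<dots> \<le> 2 * real m"
        using ln_le_minus_one[of "real n"] 2 by simp
      finally show ?thesis
        using even 2 by simp
    qed
  qed
qed

section \<open>The first theorem of Mertens\<close>

text \<open>
  Compare the two evaluations of \<^term>\<open>ln (fact n)\<close>, namely \<open>n ln n + O(n)\<close> and the sum over the
  Mangoldt function with \<open>n div d\<close>. Replacing \<open>n div d\<close> by \<open>n / d\<close> costs at most \<open>\<psi>(n) = O(n)\<close>;
  then divide by \<open>n\<close>.
\<close>
lemma mertens_first_mangoldt:
  assumes "n > 0"
  shows "\<bar>(\<Sum>d=1..n. mangoldt d / real d) - ln (real n)\<bar> \<le> 4"
proof -
  define M where "M = (\<Sum>d=1..n. mangoldt d / real d :: real)"
  have eq: "ln (fact n) = (\<Sum>d=1..n. mangoldt d * real (n div d))"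
    by (rule ln_fact_eq_sum_mangoldt) auto
  have *: "real n / real d - 1 \<le> real (n div d)" "real (n div d) \<le> real n / real d" for d
  proof -
    have "real n / real d = real (n div d) + real (n mod d) / real d"
      by (rule of_nat_of_nat_div_aux)
    moreover have "real (n mod d) / real d \<le> 1"
      by (cases "d = 0") (auto simp: divide_le_eq_1)
    moreover have "real (n mod d) / real d \<ge> 0"
      by simp
    ultimately show "real n / real d - 1 \<le> real (n div d)" "real (n div d) \<le> real n / real d"
      by linarith+
  qed
  have "ln (fact n) \<le> (\<Sum>d=1..n. mangoldt d * (real n / real d))"
    unfolding eq by (intro sum_mono mult_left_mono * mangoldt_nonneg)
  also have "\<dots> = real n * M"
    by (simp add: M_def sum_distrib_left mult_ac)
  finally have "real n * (ln (real n) - 1) \<le> real n * M"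
    using ln_fact_lower_bound[of n] by (simp add: algebra_simps)
  then have lower: "ln (real n) - 1 \<le> M"
    using assms by simp
  have "real n * M - chebyshev_psi n = (\<Sum>d=1..n. mangoldt d * (real n / real d - 1))"
    by (simp add: M_def chebyshev_psi_def sum_distrib_left sum_subtractf right_diff_distrib mult_ac)
  also have "\<dots> \<le> ln (fact n)"
    unfolding eq by (intro sum_mono mult_left_mono * mangoldt_nonneg)
  finally have "real n * M \<le> real n * (ln (real n) + 4)"
    using ln_fact_upper_bound[of n] chebyshev_psi_le[of n] by (simp add: algebra_simps)
  then have "M \<le> ln (real n) + 4"
    using assms by simp
  with lower show ?thesis
    unfolding M_def by linarith
qed

lemma sum_power_from_2_le:
  fixes x :: real
  assumes "0 \<le> x" "x \<le> 1 / 2"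
  shows "(\<Sum>k=2..n. x ^ k) \<le> 2 * x\<^sup>2"
proof (cases "n = 0")
  case False
  then have "n \<ge> 1" by simp
  then have "(\<Sum>k=2..n. x ^ k) \<le> 2 * x\<^sup>2 - 2 * x ^ Suc n"
  proof (induction n rule: dec_induct)
    case base
    show ?case by (simp add: power2_eq_square)
  next
    case (step n)
    have "x ^ Suc n * (2 * x) \<le> x ^ Suc n * 1"
      using assms by (intro mult_left_mono) auto
    then show ?case
      using step by (simp add: sum.atLeast_Suc_atMost atLeastAtMostSuc_conv algebra_simps)
  qed
  also have "\<dots> \<le> 2 * x\<^sup>2"
    using assms by simp
  finally show ?thesis .
qed auto

text \<open>
  The telescoping series in the hypothesis has terms of order \<open>n powr (-3/2)\<close>. All error terms
  below are of order \<open>ln n / n\<^sup>2\<close> or smaller, so that this one comparison series serves for all.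
\<close>
lemma summable_if_bigo_sqrt_diff:
  fixes f :: "nat \<Rightarrow> real"
  assumes "f \<in> O(\<lambda>n. 1 / sqrt (real n + 1) - 1 / sqrt (real n + 2))"
  shows "summable f"
proof (rule summable_comparison_test_bigo[OF _ assms])
  have "(\<lambda>n. 1 / sqrt (real n + 1)) \<longlonglongrightarrow> 0"
    by real_asymp
  then have "summable (\<lambda>n. 1 / sqrt (real n + 1) - 1 / sqrt (real (Suc n) + 1))"
    by (rule telescope_summable')
  then show "summable (\<lambda>n. norm (1 / sqrt (real n + 1) - 1 / sqrt (real n + 2)))"
    by (simp add: field_simps)
qed

text \<open>
  Passing from prime powers to primes: the powers \<open>p\<^sup>k\<close> with \<open>k \<ge> 2\<close> of a fixed prime contribute
  at most \<open>2 ln p / p\<^sup>2\<close>, by the geometric series, and this is summable over all \<open>p\<close>.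
\<close>
lemma bounded_sum_mangoldt_higher_prime_powers:
  "\<exists>C. \<forall>n. (\<Sum>d | d \<in> {1..n} \<and> \<not> prime d. mangoldt d / real d) \<le> C"
proof (intro exI allI)
  fix n :: nat
  define Q where "Q = {d \<in> {1..n}. primepow d \<and> \<not> prime d}"
  define P where "P = {p \<in> {1..n}. prime p}"
  have "(\<Sum>d | d \<in> {1..n} \<and> \<not> prime d. mangoldt d / real d) = (\<Sum>d\<in>Q. mangoldt d / real d)"
    by (intro sum.mono_neutral_right) (auto simp: Q_def mangoldt_def)
  also have "\<dots> \<le> (\<Sum>d\<in>(\<lambda>(p, k). p ^ k) ` (P \<times> {2..n}). mangoldt d / real d)"
  proof (rule sum_mono2)
    show "Q \<subseteq> (\<lambda>(p, k). p ^ k) ` (P \<times> {2..n})"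
    proof
      fix d assume d: "d \<in> Q"
      then obtain p k where pk: "prime p" "k > 0" "d = p ^ k"
        by (auto simp: Q_def primepow_def)
      have "k \<noteq> 1"
        using d pk by (auto simp: Q_def)
      then have "k \<ge> 2"
        using pk by simp
      moreover have "k < p ^ k" "p \<le> p ^ k"
        using pk prime_gt_1_nat[OF pk(1)] by (auto intro!: power_gt_expt self_le_power)
      moreover have "p ^ k \<le> n"
        using d pk by (auto simp: Q_def)
      ultimately have "(p, k) \<in> P \<times> {2..n}"
        using pk prime_gt_0_nat[OF pk(1)] by (auto simp: P_def)
      then show "d \<in> (\<lambda>(p, k). p ^ k) ` (P \<times> {2..n})"
        using pk by force
    qed
  qed (auto simp: P_def mangoldt_nonneg)
  also have "\<dots> \<le> (\<Sum>(p, k)\<in>P \<times> {2..n}. mangoldt (p ^ k) / real (p ^ k))"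
    by (rule order.trans[OF sum_image_le])
       (auto simp: P_def mangoldt_nonneg case_prod_unfold)
  also have "\<dots> = (\<Sum>p\<in>P. ln (real p) * (\<Sum>k=2..n. (1 / real p) ^ k))"
    by (subst sum.cartesian_product [symmetric])
       (auto simp: P_def sum_distrib_left mangoldt_primepow power_divide intro!: sum.cong)
  also have "\<dots> \<le> (\<Sum>p\<in>P. ln (real p) * (2 * (1 / real p)\<^sup>2))"
    by (intro sum_mono mult_left_mono sum_power_from_2_le)
       (auto simp: P_def field_simps dest: prime_ge_2_nat)
  also have "\<dots> \<le> (\<Sum>p. ln (real p) * (2 * (1 / real p)\<^sup>2))"
  proof (rule sum_le_suminf)
    show "summable (\<lambda>p. ln (real p) * (2 * (1 / real p)\<^sup>2))"
      by (rule summable_if_bigo_sqrt_diff) real_asymp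
    show "0 \<le> ln (real p) * (2 * (1 / real p)\<^sup>2)" for p
      by (cases "p = 0") auto
  qed (auto simp: P_def)
  finally show "(\<Sum>d | d \<in> {1..n} \<and> \<not> prime d. mangoldt d / real d)
      \<le> (\<Sum>p. ln (real p) * (2 * (1 / real p)\<^sup>2))" .
qed

lemma mertens_first:
  "\<exists>C. \<forall>n>0. \<bar>(\<Sum>p | p \<in> {1..n} \<and> prime p. ln (real p) / real p) - ln (real n)\<bar> \<le> C"
proof -
  obtain C where C: "(\<Sum>d | d \<in> {1..n} \<and> \<not> prime d. mangoldt d / real d) \<le> C" for n
    using bounded_sum_mangoldt_higher_prime_powers by blast
  show ?thesis
  proof (intro exI allI impI)
    fix n :: nat
    assume "n > 0"
    have nonneg: "0 \<le> (\<Sum>d | d \<in> {1..n} \<and> \<not> prime d. mangoldt d / real d :: real)"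
      by (intro sum_nonneg) (auto simp: mangoldt_nonneg)
    have "(\<Sum>d=1..n. mangoldt d / real d :: real)
        = (\<Sum>p | p \<in> {1..n} \<and> prime p. mangoldt p / real p)
          + (\<Sum>d | d \<in> {1..n} \<and> \<not> prime d. mangoldt d / real d)"
      by (subst sum.union_disjoint [symmetric]) (auto intro!: sum.cong)
    also have "(\<Sum>p | p \<in> {1..n} \<and> prime p. mangoldt p / real p)
        = (\<Sum>p | p \<in> {1..n} \<and> prime p. ln (real p) / real p)"
      by (intro sum.cong) auto
    finally show "\<bar>(\<Sum>p | p \<in> {1..n} \<and> prime p. ln (real p) / real p) - ln (real n)\<bar> \<le> 4 + C"
      using mertens_first_mangoldt[OF \<open>n > 0\<close>] C[of n] nonneg by linarith
  qed
qed

section \<open>The third theorem of Mertens\<close>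

text \<open>
  Dirichlet's test, by summation by parts: the boundary term tends to \<open>0\<close>, and the remaining
  series is dominated by \<open>C\<close> times the telescoping series of the decrements of \<open>f\<close>.
\<close>
lemma summable_Dirichlet_test:
  fixes f b :: "nat \<Rightarrow> real"
  assumes dec: "decseq f" and lim: "f \<longlonglongrightarrow> 0"
    and bd: "\<And>n. \<bar>\<Sum>k<n. b k\<bar> \<le> C"
  shows "summable (\<lambda>k. f k * b k)"
proof -
  define B where "B n = (\<Sum>k<n. b k)" for n
  have parts: "(\<Sum>k<n. f k * b k) = f n * B n + (\<Sum>k<n. (f k - f (Suc k)) * B (Suc k))" for n
    by (induction n) (auto simp: B_def algebra_simps)
  have "summable (\<lambda>k. f k - f (Suc k))"
    using telescope_summable'[OF lim] .
  then have "summable (\<lambda>k. C * (f k - f (Suc k)))"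
    by (rule summable_mult)
  then have "summable (\<lambda>k. (f k - f (Suc k)) * B (Suc k))"
  proof (rule summable_comparison_test')
    fix k
    have "f (Suc k) \<le> f k"
      using dec by (simp add: decseq_Suc_iff)
    then show "norm ((f k - f (Suc k)) * B (Suc k)) \<le> C * (f k - f (Suc k))"
      using bd[of "Suc k"]
      by (simp add: abs_mult B_def mult.commute[of C] mult_left_mono)
  qed
  then have "convergent (\<lambda>n. \<Sum>k<n. (f k - f (Suc k)) * B (Suc k))"
    by (simp add: summable_iff_convergent)
  moreover have "(\<lambda>n. f n * B n) \<longlonglongrightarrow> 0"
  proof (rule tendsto_0_le[OF lim])
    have "norm (f n * B n) \<le> norm (f n) * C" for n
      using bd[of n] by (simp add: abs_mult B_def mult_left_mono)
    then show "\<forall>\<^sub>F n in sequentially. norm (f n * B n) \<le> norm (f n) * C"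
      by simp
  qed
  ultimately show ?thesis
    unfolding summable_iff_convergent parts by (metis convergent_add convergentI)
qed

text \<open>
  Mertens' third theorem, with a constant that is only known to be positive.
  The logarithm of the sequence is the partial sum of the terms \<open>s k\<close> below, in which the
  \<open>ln ln\<close> of \<open>n\<close> has been written as a telescoping sum; so it suffices that this series converges.
  With \<open>m = k + 2\<close>, three corrections reduce the term to zero: replacing \<open>ln (1 - 1 / m)\<close> by \<open>- 1 / m\<close>
  at primes \<open>m\<close> costs \<open>O(1 / m\<^sup>2)\<close>; replacing the increment of \<open>ln ln\<close> by the increment of
  \<open>ln\<close> divided by \<open>ln m\<close> likewise costs \<open>O(1 / m\<^sup>2)\<close>; and what remains is \<open>- b k / ln m\<close>, where the
  partial sums of \<open>b\<close> are the bounded differences of Mertens' first theorem, so that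
  Dirichlet's test applies.
\<close>
lemma mertens_third:
  "\<exists>c>0. (\<lambda>n. (\<Prod>p | prime p \<and> p \<le> n. 1 - 1 / real p) * ln (real n)) \<longlonglongrightarrow> c"
proof -
  define P where "P n = (\<Sum>p | p \<in> {1..n} \<and> prime p. ln (real p) / real p)" for n :: nat
  obtain C where C: "\<bar>P n - ln (real n)\<bar> \<le> C" if "n > 0" for n
    using mertens_first unfolding P_def by blast
  define b where
    "b k = (if prime (k + 2) then ln (real k + 2) / (real k + 2) else 0) - (ln (real k + 2) - ln (real k + 1))"
    for k :: nat
  have P_Suc: "P (Suc n) = P n + (if prime (Suc n) then ln (real (Suc n)) / real (Suc n) else 0)" for n
  proof -
    have "{p. p \<in> {1..Suc n} \<and> prime p}
        = (if prime (Suc n) then insert (Suc n) else id) {p. p \<in> {1..n} \<and> prime p}"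
      by (auto simp: le_Suc_eq)
    then show ?thesis
      by (simp add: P_def add.commute)
  qed
  have "(\<Sum>k<n. b k) = P (Suc n) - ln (real (Suc n))" for n
  proof (induction n)
    case 0
    have "{p. p \<in> {1..Suc 0} \<and> prime p} = {}"
      by auto
    then show ?case by (simp only: P_def) simp
  next
    case (Suc n)
    then show ?case
      by (simp add: P_Suc[of "Suc n"] b_def algebra_simps)
  qed
  then have "\<bar>\<Sum>k<n. b k\<bar> \<le> C" for n
    using C[of "Suc n"] by simp
  moreover have "decseq (\<lambda>k. 1 / ln (real k + 2))"
    by (auto simp: decseq_def intro!: divide_left_mono mult_pos_pos)
  moreover have "(\<lambda>k. 1 / ln (real k + 2)) \<longlonglongrightarrow> 0"
    by real_asymp
  ultimately have sum1: "summable (\<lambda>k. 1 / ln (real k + 2) * b k)"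
    by (intro summable_Dirichlet_test)
  have sum2: "summable (\<lambda>k. (ln (real k + 2) - ln (real k + 1)) / ln (real k + 2)
      - (ln (ln (real k + 2)) - ln (ln (real k + 1))))"
    by (rule summable_if_bigo_sqrt_diff) real_asymp
  have sum3: "summable (\<lambda>k. if prime (k + 2) then ln (1 - 1 / (real k + 2)) + 1 / (real k + 2) else 0)"
  proof (rule summable_if_bigo_sqrt_diff)
    have "(\<lambda>k. if prime (k + 2) then ln (1 - 1 / (real k + 2)) + 1 / (real k + 2) else 0)
        \<in> O(\<lambda>k. ln (1 - 1 / (real k + 2)) + 1 / (real k + 2))"
      by (intro landau_o.big_mono always_eventually) auto
    also have "(\<lambda>k::nat. ln (1 - 1 / (real k + 2)) + 1 / (real k + 2))
        \<in> O(\<lambda>n. 1 / sqrt (real n + 1) - 1 / sqrt (real n + 2))"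
      by real_asymp
    finally show "(\<lambda>k. if prime (k + 2) then ln (1 - 1 / (real k + 2)) + 1 / (real k + 2) else 0)
        \<in> O(\<lambda>n. 1 / sqrt (real n + 1) - 1 / sqrt (real n + 2))" .
  qed
  define s where "s k = (if prime (k + 2) then ln (1 - 1 / (real k + 2)) else 0)
      + (ln (ln (real k + 2)) - ln (ln (real k + 1)))" for k :: nat
  have "summable s"
  proof -
    have "s k = (if prime (k + 2) then ln (1 - 1 / (real k + 2)) + 1 / (real k + 2) else 0)
        - 1 / ln (real k + 2) * b k
        - ((ln (real k + 2) - ln (real k + 1)) / ln (real k + 2)
           - (ln (ln (real k + 2)) - ln (ln (real k + 1))))" for k
    proof -
      have "ln (real k + 2) > 0" by simp
      then show ?thesis by (simp add: s_def b_def field_simps)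
    qed
    then show ?thesis
      using summable_diff[OF summable_diff[OF sum3 sum1] sum2] by presburger
  qed
  then obtain L where "(\<lambda>n. \<Sum>k<n. s k) \<longlonglongrightarrow> L"
    by (auto simp: summable_def sums_def)
  then have lim: "(\<lambda>n. exp (\<Sum>k<Suc n. s k)) \<longlonglongrightarrow> exp L"
    by (intro tendsto_exp LIMSEQ_Suc)
  define Q where "Q n = (\<Prod>p | prime p \<and> p \<le> n. 1 - 1 / real p)" for n :: nat
  have Q_Suc: "Q (Suc n) = Q n * (if prime (Suc n) then 1 - 1 / real (Suc n) else 1)" for n
  proof -
    have "{p. prime p \<and> p \<le> Suc n}
        = (if prime (Suc n) then insert (Suc n) else id) {p. prime p \<and> p \<le> n}"
      by (auto simp: le_Suc_eq)
    then show ?thesis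
      by (simp add: Q_def mult.commute)
  qed
  \<comment> \<open>For \<open>k = 0\<close>, the term \<open>s k\<close> contains \<open>ln (ln 1) = ln 0\<close>, whose conventional value \<open>0\<close> makes
    the telescoping sum start at the right value. The claim begins at \<open>n + 2 \<ge> 2\<close>, where
    \<open>exp (ln (ln x)) = ln x\<close> holds.\<close>
  have "exp (\<Sum>k<Suc n. s k) = Q (n + 2) * ln (real (n + 2))" for n
  proof (induction n)
    case 0
    have "{p::nat. prime p \<and> p \<le> 2} = {2}"
      by (auto dest: prime_ge_2_nat)
    then show ?case by (simp add: s_def Q_def exp_add flip: numeral_2_eq_2)
  next
    case (Suc n)
    have "exp (\<Sum>k<Suc (Suc n). s k) = Q (n + 2) * ln (real (n + 2)) * exp (s (Suc n))"
      using Suc by (simp add: exp_add)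
    also have "exp (s (Suc n)) = (if prime (n + 3) then 1 - 1 / (real n + 3) else 1)
        * (ln (real n + 3) / ln (real n + 2))"
      by (auto simp: s_def exp_add exp_diff add.commute numeral_3_eq_3)
    finally show ?case
      using Q_Suc[of "n + 2"] by (simp add: add.commute numeral_3_eq_3 eval_nat_numeral)
  qed
  with lim have "(\<lambda>n. Q (n + 2) * ln (real (n + 2))) \<longlonglongrightarrow> exp L"
    by simp
  then have "(\<lambda>n. Q n * ln (real n)) \<longlonglongrightarrow> exp L"
    by (rule LIMSEQ_offset)
  then show ?thesis
    unfolding Q_def by (intro exI[of _ "exp L"]) auto
qed

section \<open>From summands to sums\<close>

text \<open>
  The Stolz-Cesaro theorem. Subtracting \<open>L * u\<close> from \<open>S\<close> reduces it to limit \<open>0\<close>: from some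
  \<open>N\<close> on, the increments of the difference are at most \<open>e / 2\<close> times those of \<open>u\<close>, and these
  telescope. The fixed contribution \<open>K\<close> of the initial segment is negligible against \<open>u\<close>.
\<close>
theorem stolz_cesaro:
  fixes S u :: "nat \<Rightarrow> real"
  assumes inc: "\<forall>\<^sub>F n in sequentially. u n < u (Suc n)"
    and u: "filterlim u at_top sequentially"
    and lim: "(\<lambda>n. (S (Suc n) - S n) / (u (Suc n) - u n)) \<longlonglongrightarrow> L"
  shows "(\<lambda>n. S n / u n) \<longlonglongrightarrow> L"
proof (rule tendstoI)
  fix e :: real
  assume "e > 0"
  have "\<forall>\<^sub>F n in sequentially. dist ((S (Suc n) - S n) / (u (Suc n) - u n)) L < e / 2"
    using lim \<open>e > 0\<close> by (intro tendstoD) auto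
  with inc have "\<forall>\<^sub>F n in sequentially.
      \<bar>(S (Suc n) - L * u (Suc n)) - (S n - L * u n)\<bar> \<le> e / 2 * (u (Suc n) - u n)"
  proof eventually_elim
    case (elim n)
    have "(S (Suc n) - L * u (Suc n)) - (S n - L * u n)
        = ((S (Suc n) - S n) / (u (Suc n) - u n) - L) * (u (Suc n) - u n)"
      using elim(1) by (simp add: field_simps)
    then show ?case
      using elim by (simp add: abs_mult dist_real_def mult_right_mono)
  qed
  then obtain N where N: "\<bar>(S (Suc n) - L * u (Suc n)) - (S n - L * u n)\<bar> \<le> e / 2 * (u (Suc n) - u n)"
    if "n \<ge> N" for n
    unfolding eventually_sequentially by blast
  define K where "K = \<bar>S N - L * u N\<bar> + e / 2 * \<bar>u N\<bar>"
  have bound: "\<bar>S n - L * u n\<bar> \<le> K + e / 2 * u n" if "n \<ge> N" for n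
  proof -
    have "\<bar>(S n - L * u n) - (S N - L * u N)\<bar> \<le> e / 2 * (u n - u N)"
      using that
    proof (induction n rule: dec_induct)
      case (step n)
      then show ?case
        using N[of n] by (simp add: right_diff_distrib)
    qed auto
    moreover have "- (e / 2 * u N) \<le> e / 2 * \<bar>u N\<bar>"
      using \<open>e > 0\<close> by (simp add: abs_if)
    ultimately show ?thesis
      unfolding K_def right_diff_distrib by linarith
  qed
  have "\<forall>\<^sub>F n in sequentially. u n > max 0 (2 * K / e)"
    using u by (simp only: filterlim_at_top_dense)
  then show "\<forall>\<^sub>F n in sequentially. dist (S n / u n) L < e"
    using eventually_ge_at_top[of N]
  proof eventually_elim
    case (elim n)
    have "K < e / 2 * u n"
      using elim(1) \<open>e > 0\<close> by (simp add: field_simps)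
    then have "\<bar>S n - L * u n\<bar> < e * u n"
      using bound[OF elim(2)] by (simp add: field_simps)
    moreover have "S n / u n - L = (S n - L * u n) / u n"
      using elim(1) by (simp add: field_simps)
    ultimately show ?case
      using elim(1) by (simp add: dist_real_def abs_divide divide_less_eq)
  qed
qed

lemma tendsto_ln_floor_sqrt_ratio:
  "(\<lambda>j::nat. ln (real j) / ln (real (nat \<lfloor>sqrt (real j)\<rfloor>))) \<longlonglongrightarrow> 2"
proof -
  have "(\<lambda>j::nat. ln (real j) / ln (real_of_int \<lfloor>sqrt (real j)\<rfloor>)) \<longlonglongrightarrow> 2"
    by real_asymp
  then show ?thesis by simp
qed

lemma filterlim_floor_sqrt: "filterlim (\<lambda>j::nat. nat \<lfloor>sqrt (real j)\<rfloor>) at_top sequentially"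
  unfolding filterlim_at_top
proof
  fix Z :: nat
  show "\<forall>\<^sub>F j in sequentially. Z \<le> nat \<lfloor>sqrt (real j)\<rfloor>"
    using eventually_ge_at_top[of "Z\<^sup>2"]
  proof eventually_elim
    case (elim j)
    then have "(real Z)\<^sup>2 \<le> real j"
      by (metis of_nat_le_iff of_nat_power)
    then have "real Z \<le> sqrt (real j)"
      by (rule real_le_rsqrt)
    then show ?case
      by (simp add: le_nat_iff le_floor_iff)
  qed
qed

text \<open>
  The comparison sequence \<open>n / ln n\<close> grows by about \<open>1 / ln n\<close> per step. Multiplying out leaves
  \<open>1 - n (ln (n + 1) - ln n) / ln n\<close>, where the increment of \<open>ln\<close> has to be rewritten as
  \<open>ln (1 + 1 / n)\<close> for its size \<open>1 / n\<close> to become visible.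
\<close>
lemma ln_times_diff_n_over_ln:
  "(\<lambda>n. ln (real (Suc n)) * (real (Suc n) / ln (real (Suc n)) - real n / ln (real n))) \<longlonglongrightarrow> 1"
proof -
  have "(\<lambda>n. 1 - real n * ln (1 + 1 / real n) / ln (real n)) \<longlonglongrightarrow> 1"
    by real_asymp
  moreover have "\<forall>\<^sub>F n in sequentially. 1 - real n * ln (1 + 1 / real n) / ln (real n)
      = ln (real (Suc n)) * (real (Suc n) / ln (real (Suc n)) - real n / ln (real n))"
    using eventually_gt_at_top[of 1]
  proof eventually_elim
    case (elim n)
    have "1 + 1 / real n = real (Suc n) / real n"
      using elim by (simp add: field_simps)
    then have "ln (1 + 1 / real n) = ln (real (Suc n)) - ln (real n)"
      using elim by (simp add: ln_div)
    moreover have "ln (real n) > 0" "ln (real (Suc n)) > 0"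
      using elim by auto
    ultimately show ?case
      by (simp only:) (simp add: field_simps)
  qed
  ultimately show ?thesis
    by (rule Lim_transform_eventually)
qed

section \<open>Products over the first primes\<close>

text \<open>
  A strictly increasing enumeration lists the elements up to \<open>m\<close> first. Since
  \<^const>\<open>enumerate\<close> counts from \<open>0\<close>, index \<open>i\<close> belongs to them iff their number exceeds \<open>i\<close>.
\<close>
lemma enumerate_image_lessThan_card:
  fixes S :: "nat set"
  assumes "infinite S"
  shows "enumerate S ` {..<card {s \<in> S. s \<le> m}} = {s \<in> S. s \<le> m}"
proof -
  let ?T = "{s \<in> S. s \<le> m}"
  have card_image: "card (enumerate S ` A) = card A" for A
    using inj_enumerate[OF assms] by (intro card_image) (auto intro: inj_on_subset)
  have "i < card ?T \<longleftrightarrow> enumerate S i \<le> m" for i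
  proof
    assume "enumerate S i \<le> m"
    then have "enumerate S ` {..i} \<subseteq> ?T"
      using assms by (auto simp: enumerate_in_set intro: order.trans[of _ "enumerate S i"])
    then have "card (enumerate S ` {..i}) \<le> card ?T"
      by (intro card_mono) auto
    then show "i < card ?T"
      by (simp add: card_image)
  next
    assume less: "i < card ?T"
    show "enumerate S i \<le> m"
    proof (rule ccontr)
      assume gt: "\<not> enumerate S i \<le> m"
      have "?T \<subseteq> enumerate S ` {..<i}"
      proof
        fix s assume s: "s \<in> ?T"
        then obtain j where "s = enumerate S j"
          using enumerate_Ex[OF assms, of s] by auto
        moreover from this have "j < i"
          using s gt assms by (metis (no_types, lifting) enumerate_mono_le_iff le_trans mem_Collect_eq not_le)
        ultimately show "s \<in> enumerate S ` {..<i}" by auto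
      qed
      then have "card ?T \<le> card (enumerate S ` {..<i})"
        by (intro card_mono) auto
      with less show False
        by (simp add: card_image)
    qed
  qed
  then have "{..<card ?T} = {i. enumerate S i \<le> m}"
    by auto
  moreover have "enumerate S ` {i. enumerate S i \<le> m} = ?T"
    using assms enumerate_Ex[OF assms] by (force simp: enumerate_in_set)
  ultimately show ?thesis by simp
qed

lemma prod_nth_prime:
  fixes f :: "nat \<Rightarrow> 'a :: comm_monoid_mult"
  assumes "x \<ge> 0"
  shows "(\<Prod>i=1..prime_pi x. f (nth_prime i)) = (\<Prod>p | prime p \<and> p \<le> nat \<lfloor>x\<rfloor>. f p)"
proof -
  let ?S = "{p::nat. prime p}"
  have le_iff: "real p \<le> x \<longleftrightarrow> p \<le> nat \<lfloor>x\<rfloor>" for p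
    using assms by (simp add: le_nat_iff le_floor_iff)
  have inf: "infinite ?S"
    by (rule primes_infinite)
  have "(\<Prod>i=1..prime_pi x. f (nth_prime i)) = (\<Prod>i<prime_pi x. f (enumerate ?S i))"
    by (rule prod.reindex_bij_witness[of _ Suc "\<lambda>i. i - 1"]) (auto simp: nth_prime_def)
  also have "\<dots> = (\<Prod>p\<in>enumerate ?S ` {..<prime_pi x}. f p)"
    using inj_enumerate[OF inf] by (subst prod.reindex) (auto intro: inj_on_subset)
  also have "enumerate ?S ` {..<prime_pi x} = {p. prime p \<and> p \<le> nat \<lfloor>x\<rfloor>}"
    using enumerate_image_lessThan_card[OF inf, of "nat \<lfloor>x\<rfloor>"] by (simp add: prime_pi_def le_iff del: of_nat_le_iff)
  finally show ?thesis .
qed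

section \<open>The asymptotics of the sum\<close>

theorem corollary2p21:
  shows "\<exists>a::real. (\<lambda>n. pi_L n) \<sim>[sequentially] (\<lambda>n. a * (real n / ln (real n)))"
proof -
  define Q where "Q m = (\<Prod>p | prime p \<and> p \<le> m. 1 - 1 / real p)" for m :: nat
  define t where "t j = (\<Prod>i=1..prime_pi (sqrt (real j)). 1 - 1 / real (nth_prime i))" for j :: nat
  define m where "m j = nat \<lfloor>sqrt (real j)\<rfloor>" for j :: nat
  define u where "u n = real n / ln (real n)" for n :: nat
  obtain c where c: "c > 0" "(\<lambda>n. Q n * ln (real n)) \<longlonglongrightarrow> c"
    using mertens_third unfolding Q_def by blast
  have t_eq: "t j = Q (m j)" for j
    unfolding t_def Q_def m_def by (rule prod_nth_prime) auto
  have m: "filterlim m at_top sequentially"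
    unfolding m_def by (rule filterlim_floor_sqrt)
  \<comment> \<open>Mertens' theorem at \<open>m j\<close>; the limit doubles because \<open>ln j\<close> is about \<open>2 ln (m j)\<close>.\<close>
  have "(\<lambda>j. Q (m j) * ln (real (m j)) * (ln (real j) / ln (real (m j)))) \<longlonglongrightarrow> c * 2"
    by (intro tendsto_mult filterlim_compose[OF c(2) m] tendsto_ln_floor_sqrt_ratio[folded m_def])
  moreover have "\<forall>\<^sub>F j in sequentially. m j \<ge> 2"
    using m by (simp add: filterlim_at_top)
  then have "\<forall>\<^sub>F j in sequentially.
      Q (m j) * ln (real (m j)) * (ln (real j) / ln (real (m j))) = t j * ln (real j)"
    by eventually_elim (simp add: t_eq)
  ultimately have t_lim: "(\<lambda>j. t j * ln (real j)) \<longlonglongrightarrow> c * 2"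
    by (rule Lim_transform_eventually)
  have u_diff: "(\<lambda>n. ln (real (Suc n)) * (u (Suc n) - u n)) \<longlonglongrightarrow> 1"
    unfolding u_def by (rule ln_times_diff_n_over_ln)
  have "(\<lambda>n. t (Suc n) * ln (real (Suc n)) / (ln (real (Suc n)) * (u (Suc n) - u n))) \<longlonglongrightarrow> c * 2"
    using tendsto_divide[OF LIMSEQ_Suc[OF t_lim] u_diff] by simp
  moreover have "\<forall>\<^sub>F n in sequentially.
      t (Suc n) * ln (real (Suc n)) / (ln (real (Suc n)) * (u (Suc n) - u n))
        = (pi_L (Suc n) - pi_L n) / (u (Suc n) - u n)"
    using eventually_gt_at_top[of 0] by eventually_elim (simp add: pi_L_def t_def)
  ultimately have "(\<lambda>n. (pi_L (Suc n) - pi_L n) / (u (Suc n) - u n)) \<longlonglongrightarrow> c * 2"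
    by (rule Lim_transform_eventually)
  moreover have "\<forall>\<^sub>F n in sequentially. u n < u (Suc n)"
    using order_tendstoD(1)[OF u_diff zero_less_one] eventually_gt_at_top[of 0]
    by eventually_elim (simp add: zero_less_mult_iff)
  moreover have "filterlim u at_top sequentially"
    unfolding u_def by real_asymp
  ultimately have "(\<lambda>n. pi_L n / u n) \<longlonglongrightarrow> c * 2"
    by (rule stolz_cesaro[rotated 2])
  then have "pi_L \<sim>[sequentially] (\<lambda>n. c * 2 * u n)"
    using c(1) by (intro asymp_equivI'_const) auto
  then show ?thesis
    unfolding u_def by blast
qed

end
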